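(* Fix a prompt $x\in\mathcal X$, a threshold $b\in(0,1]$ and an integer $N\ge 1$. Let $y_1,\ldots,y_N$ be i.i.d. from $\pi_{\mathrm{ref}}(\cdot\mid x)$, and let $\widehat y_N^{\mathrm{BoN}}(x)$ be the output of constrained Best-of-$N$ on these candidates. For $t,s\in\mathbb R$ define $$\widehat L_N(t;x,b):=\bigl(1-\widehat\Psi_A(t;x,b)\bigr)^N-\bigl(1-\widehat\Psi_A(t;x,b)-\widehat\Psi_B(t;x,b)\bigr)^N,$$ $$\widehat U_N(s;x,b):=1-\bigl(1-\widehat\Psi_B(s;x,b)\bigr)^N+\bigl(1-\widehat\Psi_B(s;x,b)-\widehat\Psi_A(s;x,b)\bigr)^N.$$ Then for every $t,s\in\mathbb R$, $$\widehat L_N(t;x,b)\;\le\;\mathbb P\left[\widehat y_N^{\mathrm{BoN}}(x)\in B(x,b)\right]\;\le\;\widehat U_N(s;x,b).$$ (Consequently the same holds with $\sup_t\widehat L_N(t;x,b)$ on the left and $\inf_s\widehat U_N(s;x,b)$ on the right.)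
   Context: Setting. $\mathcal X$ is a set of prompts and $\mathcal Y$ is a finite or countable set of outputs. $\pi_{\mathrm{ref}}(\cdot\mid x)$ is a probability distribution on $\mathcal Y$ for each $x$ (reference policy). There are a true binary safety function $g^\star:\mathcal X\times\mathcal Y\to\{0,1\}$ (an output $y$ is truly safe if $g^\star(x,y)=1$), a learned reward proxy $\widehat r:\mathcal X\times\mathcal Y\to\mathbb R$, and a learned safety proxy $\widehat g:\mathcal X\times\mathcal Y\to[0,1]$. For $b\in(0,1]$ the proxy-feasible set is $\widehat{\mathcal S}_+(x,b)=\{y\in\mathcal Y:\widehat g(x,y)\ge b\}$. Put $A(x,b)=\{y\in\widehat{\mathcal S}_+(x,b): g^\star(x,y)=1\}$ and $B(x,b)=\{y\in\widehat{\mathcal S}_+(x,b): g^\star(x,y)=0\}$. For $\lozenge\in\{A,B\}$ and $t\in\mathbb R$, the learned-score tail is $\widehat\Psi_\lozenge(t;x,b)=\mathbb P_{y\sim\pi_{\mathrm{ref}}(\cdot\mid x)}[y\in\lozenge(x,b),\ \widehat r(x,y)>t]$. Constrained Best-of-$N$: given candidates $y_1,\ldots,y_N$, let $\mathcal I_N(x,b)=\{i\in\{1,\dots,N\}: y_i\in\widehat{\mathcal S}_+(x,b)\}$. If $\mathcal I_N(x,b)\ne\varnothing$, it returns $\widehat y_N^{\mathrm{BoN}}(x)=y_{i^*}$ for some $i^*\in\arg\max_{i\in\mathcal I_N(x,b)}\widehat r(x,y_i)$, ties being broken arbitrarily. If $\mathcal I_N(x,b)=\varnothing$ it abstains, and abstention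 does not count as the event $\widehat y_N^{\mathrm{BoN}}(x)\in B(x,b)$. *)

theory Defs
  imports "HOL-Probability.Probability"
begin

definition feasible :: "('x \<Rightarrow> 'y \<Rightarrow> real) \<Rightarrow> 'x \<Rightarrow> real \<Rightarrow> 'y set" where
  "feasible ghat x b = {y. ghat x y \<ge> b}"

definition safe_feasible ::
  "('x \<Rightarrow> 'y \<Rightarrow> nat) \<Rightarrow> ('x \<Rightarrow> 'y \<Rightarrow> real) \<Rightarrow> 'x \<Rightarrow> real \<Rightarrow> 'y set" where
  "safe_feasible gstar ghat x b = {y \<in> feasible ghat x b. gstar x y = 1}"

definition unsafe_feasible ::
  "('x \<Rightarrow> 'y \<Rightarrow> nat) \<Rightarrow> ('x \<Rightarrow> 'y \<Rightarrow> real) \<Rightarrow> 'x \<Rightarrow> real \<Rightarrow> 'y set" where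
  "unsafe_feasible gstar ghat x b = {y \<in> feasible ghat x b. gstar x y = 0}"

definition score_tail ::
  "('x \<Rightarrow> 'y pmf) \<Rightarrow> ('x \<Rightarrow> 'y \<Rightarrow> real) \<Rightarrow> 'y set \<Rightarrow> 'x \<Rightarrow> real \<Rightarrow> real" where
  "score_tail piref rhat S x t = measure_pmf.prob (piref x) {y \<in> S. rhat x y > t}"

definition Psi_A where
  "Psi_A piref gstar rhat ghat x b t =
     score_tail piref rhat (safe_feasible gstar ghat x b) x t"

definition Psi_B where
  "Psi_B piref gstar rhat ghat x b t =
     score_tail piref rhat (unsafe_feasible gstar ghat x b) x t"

definition L_hat where
  "L_hat piref gstar rhat ghat x b (N::nat) t =
     (1 - Psi_A piref gstar rhat ghat x b t) ^ N
     - (1 - Psi_A piref gstar rhat ghat x b t - Psi_B piref gstar rhat ghat x b t) ^ N"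

definition U_hat where
  "U_hat piref gstar rhat ghat x b (N::nat) s =
     1 - (1 - Psi_B piref gstar rhat ghat x b s) ^ N
     + (1 - Psi_B piref gstar rhat ghat x b s - Psi_A piref gstar rhat ghat x b s) ^ N"

definition feasible_indices ::
  "('x \<Rightarrow> 'y \<Rightarrow> real) \<Rightarrow> 'x \<Rightarrow> real \<Rightarrow> nat \<Rightarrow> (nat \<Rightarrow> 'y) \<Rightarrow> nat set" where
  "feasible_indices ghat x b N ys = {i \<in> {1..N}. ys i \<in> feasible ghat x b}"

text \<open>A relation rather than a function, because ties are broken arbitrarily: \<open>out\<close> is an
  admissible output of constrained Best-of-\<open>N\<close> on the candidates \<open>ys 1, \<dots>, ys N\<close>.
  Abstention is \<open>None\<close>.\<close>

definition is_BoN_output ::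
  "('x \<Rightarrow> 'y \<Rightarrow> real) \<Rightarrow> ('x \<Rightarrow> 'y \<Rightarrow> real) \<Rightarrow> 'x \<Rightarrow> real \<Rightarrow> nat \<Rightarrow> (nat \<Rightarrow> 'y) \<Rightarrow> 'y option \<Rightarrow> bool"
  where
  "is_BoN_output rhat ghat x b N ys out \<longleftrightarrow>
     (if feasible_indices ghat x b N ys = {} then out = None
      else \<exists>i. is_arg_max (\<lambda>i. rhat x (ys i)) (\<lambda>i. i \<in> feasible_indices ghat x b N ys) i
               \<and> out = Some (ys i))"

definition iid_from :: "'w measure \<Rightarrow> nat \<Rightarrow> (nat \<Rightarrow> 'w \<Rightarrow> 'y) \<Rightarrow> 'y pmf \<Rightarrow> bool" where
  "iid_from M N Y p \<longleftrightarrow>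
     prob_space.indep_vars M (\<lambda>_. count_space UNIV) Y {1..N} \<and>
     (\<forall>i\<in>{1..N}. distr M (count_space UNIV) (Y i) = measure_pmf p)"

end

theory Submission
  imports Defs
begin

text \<open>If no candidate of one kind (safe or unsafe, within the feasible set) scores above a level
  but some candidate of the other kind does, then the maximiser scores above the level and is
  therefore of the other kind. By independence this event has probability equal to a difference of
  two \<open>N\<close>-th powers, which is the lower bound for the probability of an unsafe output; with the two
  kinds exchanged it bounds the probability of the complement, which is the upper bound.\<close>

text \<open>The pointwise core, free of probability. Every maximiser scores above \<open>t\<close>
  as soon as one feasible candidate does, so the way ties are broken does not matter. The two parts
  \<open>S\<close> and \<open>T\<close> stay abstract so that safe and unsafe can later be
  exchanged.\<close>

lemma BoN_output_in_part:
  assumes out: "is_BoN_output rhat ghat x b N ys out"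
    and part: "feasible ghat x b = S \<union> T"
    and no_S: "\<forall>i\<in>{1..N}. ys i \<notin> {y \<in> S. rhat x y > t}"
    and some_T: "\<exists>i\<in>{1..N}. ys i \<in> {y \<in> T. rhat x y > t}"
  shows "out \<in> Some ` T"
proof -
  obtain j where j: "j \<in> feasible_indices ghat x b N ys" "rhat x (ys j) > t"
    using some_T unfolding feasible_indices_def part by blast
  then obtain i where i: "is_arg_max (\<lambda>i. rhat x (ys i)) (\<lambda>i. i \<in> feasible_indices ghat x b N ys) i"
    and out_eq: "out = Some (ys i)"
    using out by (auto simp: is_BoN_output_def split: if_splits)
  \<comment> \<open>The maximiser \<open>i\<close> scores at least as high as the feasible index
    \<open>j\<close>.\<close>
  have "rhat x (ys i) > t"
    using i j by (force simp: is_arg_max_linorder)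
  moreover have "i \<in> {1..N}" "ys i \<in> S \<union> T"
    using i part by (auto simp: is_arg_max_def feasible_indices_def)
  ultimately have "ys i \<in> T"
    using no_S by auto
  then show ?thesis
    using out_eq by simp
qed

lemma sets_Collect_in:
  assumes "f \<in> M \<rightarrow>\<^sub>M count_space UNIV"
  shows "{\<omega> \<in> space M. f \<omega> \<in> C} \<in> sets M"
  using measurable_sets[OF assms, of C] by (simp add: vimage_def Int_def conj_commute)

lemma iid_from_measurable:
  assumes "prob_space M" "iid_from M N Y p" "i \<in> {1..N}"
  shows "Y i \<in> M \<rightarrow>\<^sub>M count_space UNIV"
  using assms by (auto simp: iid_from_def prob_space.indep_vars_def)

lemma prob_iid_all_notin:
  assumes M: "prob_space M" and iid: "iid_from M N Y p" and "N \<ge> 1"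
  shows "measure M {\<omega> \<in> space M. \<forall>i\<in>{1..N}. Y i \<omega> \<notin> S} = (1 - measure_pmf.prob p S) ^ N"
proof -
  interpret prob_space M by fact
  have "prob (Y i -` (- S) \<inter> space M) = 1 - measure_pmf.prob p S" if i: "i \<in> {1..N}" for i
  proof -
    have "prob (Y i -` (- S) \<inter> space M) = measure (distr M (count_space UNIV) (Y i)) (- S)"
      using iid_from_measurable[OF M iid i] by (simp add: measure_distr)
    also have "\<dots> = 1 - measure_pmf.prob p S"
      using iid i measure_pmf.prob_compl[of S p]
      by (simp add: iid_from_def Compl_eq_Diff_UNIV)
    finally show ?thesis .
  qed
  moreover have "prob (\<Inter>i\<in>{1..N}. Y i -` (- S) \<inter> space M)
      = (\<Prod>i\<in>{1..N}. prob (Y i -` (- S) \<inter> space M))"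
    using iid \<open>N \<ge> 1\<close> by (intro indep_varsD_finite) (auto simp: iid_from_def)
  \<comment> \<open>Here \<open>N \<ge> 1\<close> matters: an intersection over no indices would be
    \<open>UNIV\<close> instead of \<open>space M\<close>.\<close>
  moreover have "{\<omega> \<in> space M. \<forall>i\<in>{1..N}. Y i \<omega> \<notin> S} = (\<Inter>i\<in>{1..N}. Y i -` (- S) \<inter> space M)"
    using \<open>N \<ge> 1\<close> by auto
  ultimately show ?thesis by simp
qed

lemma sets_iid_all_notin:
  assumes "prob_space M" "iid_from M N Y p"
  shows "{\<omega> \<in> space M. \<forall>i\<in>{1..N}. Y i \<omega> \<notin> S} \<in> sets M"
proof (intro sets.sets_Collect_finite_All)
  fix i assume "i \<in> {1..N}"
  then show "{\<omega> \<in> space M. Y i \<omega> \<notin> S} \<in> sets M"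
    using sets_Collect_in[OF iid_from_measurable[OF assms], of i "- S"] by simp
qed simp

text \<open>Missing \<open>S\<close> but hitting \<open>T\<close> means missing \<open>S\<close>
  without missing all of \<open>S \<union> T\<close>. The second missing event lies inside the
  first, so their probabilities subtract, and disjointness splits the mass of
  \<open>S \<union> T\<close>.\<close>

lemma prob_iid_all_notin_some_in:
  assumes M: "prob_space M" and iid: "iid_from M N Y p" and N: "N \<ge> 1" and disj: "S \<inter> T = {}"
  defines "E \<equiv> {\<omega> \<in> space M. (\<forall>i\<in>{1..N}. Y i \<omega> \<notin> S) \<and> (\<exists>i\<in>{1..N}. Y i \<omega> \<in> T)}"
  shows "measure M E = (1 - measure_pmf.prob p S) ^ N
           - (1 - measure_pmf.prob p S - measure_pmf.prob p T) ^ N"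
proof -
  interpret prob_space M by fact
  let ?F = "\<lambda>S. {\<omega> \<in> space M. \<forall>i\<in>{1..N}. Y i \<omega> \<notin> S}"
  have E: "E = ?F S - ?F (S \<union> T)"
    by (auto simp: E_def)
  note F_sets = sets_iid_all_notin[OF M iid]
  have "prob E = prob (?F S) - prob (?F (S \<union> T))"
    unfolding E by (intro finite_measure_Diff F_sets) auto
  also have "\<dots> = (1 - measure_pmf.prob p S) ^ N - (1 - measure_pmf.prob p (S \<union> T)) ^ N"
    by (simp only: prob_iid_all_notin[OF M iid N])
  also have "measure_pmf.prob p (S \<union> T) = measure_pmf.prob p S + measure_pmf.prob p T"
    using disj by (intro measure_pmf.finite_measure_Union) auto
  finally show "prob E = (1 - measure_pmf.prob p S) ^ N
      - (1 - measure_pmf.prob p S - measure_pmf.prob p T) ^ N"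
    by (simp add: algebra_simps)
qed

text \<open>The event \<open>E\<close> that forces an output in \<open>T\<close> is determined by
  the candidates and has an exact probability. The event on \<open>yhat\<close> also depends on the
  tie-breaking, so its measurability comes from that of \<open>yhat\<close>, and only an inclusion
  links the two.\<close>

lemma BoN_prob_ge:
  assumes M: "prob_space M" and iid: "iid_from M N Y (piref x)" and N: "N \<ge> 1"
    and yhat_measurable: "yhat \<in> M \<rightarrow>\<^sub>M count_space UNIV"
    and yhat: "\<And>\<omega>. \<omega> \<in> space M \<Longrightarrow> is_BoN_output rhat ghat x b N (\<lambda>i. Y i \<omega>) (yhat \<omega>)"
    and part: "feasible ghat x b = S \<union> T" and disj: "S \<inter> T = {}"
  shows "(1 - score_tail piref rhat S x t) ^ N
           - (1 - score_tail piref rhat S x t - score_tail piref rhat T x t) ^ N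
         \<le> measure M {\<omega> \<in> space M. yhat \<omega> \<in> Some ` T}"
proof -
  interpret prob_space M by fact
  let ?S = "{y \<in> S. rhat x y > t}" and ?T = "{y \<in> T. rhat x y > t}"
  let ?E = "{\<omega> \<in> space M. (\<forall>i\<in>{1..N}. Y i \<omega> \<notin> ?S) \<and> (\<exists>i\<in>{1..N}. Y i \<omega> \<in> ?T)}"
  have "?S \<inter> ?T = {}"
    using disj by auto
  note E = prob_iid_all_notin_some_in[OF M iid N this]
  have "?E \<subseteq> {\<omega> \<in> space M. yhat \<omega> \<in> Some ` T}"
    using BoN_output_in_part[OF yhat part] by blast
  moreover have "{\<omega> \<in> space M. yhat \<omega> \<in> Some ` T} \<in> sets M"
    by (rule sets_Collect_in[OF yhat_measurable])
  ultimately have "prob ?E \<le> prob {\<omega> \<in> space M. yhat \<omega> \<in> Some ` T}"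
    by (intro finite_measure_mono)
  then show ?thesis
    using E by (simp add: score_tail_def)
qed

theorem theorem4p1:
  fixes piref :: "'x \<Rightarrow> ('y::countable) pmf"
    and gstar :: "'x \<Rightarrow> 'y \<Rightarrow> nat"
    and rhat ghat :: "'x \<Rightarrow> 'y \<Rightarrow> real"
    and x :: 'x and b :: real and N :: nat
    and M :: "'w measure"
    and Y :: "nat \<Rightarrow> 'w \<Rightarrow> 'y"
    and yhat :: "'w \<Rightarrow> 'y option"
  assumes gstar: "\<And>x y. gstar x y \<in> {0, 1}"
    and ghat: "\<And>x y. ghat x y \<in> {0..1}"
    and b: "0 < b" "b \<le> 1"
    and N: "N \<ge> 1"
    and M: "prob_space M"
    and iid: "iid_from M N Y (piref x)"
    and yhat_measurable: "yhat \<in> M \<rightarrow>\<^sub>M count_space UNIV"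
    and yhat: "\<And>\<omega>. \<omega> \<in> space M \<Longrightarrow> is_BoN_output rhat ghat x b N (\<lambda>i. Y i \<omega>) (yhat \<omega>)"
  defines "p \<equiv> measure M {\<omega> \<in> space M. yhat \<omega> \<in> Some ` unsafe_feasible gstar ghat x b}"
  shows "(\<forall>t s. L_hat piref gstar rhat ghat x b N t \<le> p \<and> p \<le> U_hat piref gstar rhat ghat x b N s) \<and>
         (SUP t. L_hat piref gstar rhat ghat x b N t) \<le> p \<and>
         p \<le> (INF s. U_hat piref gstar rhat ghat x b N s)"
proof -
  interpret prob_space M by fact
  let ?A = "safe_feasible gstar ghat x b" and ?B = "unsafe_feasible gstar ghat x b"
  have part: "feasible ghat x b = ?A \<union> ?B"
    using gstar[of x] unfolding safe_feasible_def unsafe_feasible_def by blast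
  have disj: "?A \<inter> ?B = {}"
    by (auto simp: safe_feasible_def unsafe_feasible_def)
  note bound = BoN_prob_ge[where yhat = yhat and rhat = rhat and piref = piref,
      OF M iid N yhat_measurable yhat]
  have lower: "L_hat piref gstar rhat ghat x b N t \<le> p" for t
    unfolding L_hat_def Psi_A_def Psi_B_def p_def by (rule bound[OF _ part disj])
  note meas = sets_Collect_in[OF yhat_measurable]
  \<comment> \<open>The lower bound with the roles of \<open>?A\<close> and \<open>?B\<close>
    exchanged bounds the probability of a safe output from below.\<close>
  have upper: "p \<le> U_hat piref gstar rhat ghat x b N s" for s
  proof -
    have "p + prob {\<omega> \<in> space M. yhat \<omega> \<in> Some ` ?A}
        = prob ({\<omega> \<in> space M. yhat \<omega> \<in> Some ` ?B} \<union> {\<omega> \<in> space M. yhat \<omega> \<in> Some ` ?A})"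
      unfolding p_def using disj by (intro finite_measure_Union[symmetric] meas) auto
    \<comment> \<open>In general only an inequality: the missing mass is the probability of
      abstaining.\<close>
    also have "\<dots> \<le> 1"
      by (rule prob_le_1)
    finally show ?thesis
      using bound[of ?B ?A s] part disj
      by (simp add: U_hat_def Psi_A_def Psi_B_def Un_commute Int_commute)
  qed
  \<comment> \<open>The pointwise bounds by \<open>p\<close> also guarantee that the real-valued
    \<open>SUP\<close> and \<open>INF\<close> are taken over sets bounded on the relevant
    side.\<close>
  show ?thesis
    using lower upper by (auto intro: cSUP_least cINF_greatest)
qed

end
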